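(* Let $n\ge 1$, let $L\in\mathbb{R}^{n\times n}$ be a nominal liability matrix (with zero diagonal), and let $\mathbf{b}=(b_1,\dots,b_n)$ be its net position vector. Let $M\in\mathbb{R}^{n\times n}$ be a minimum-cost maximum-flow matrix for $L$, that is, a matrix minimizing $\mu(M)=\sum_{i=1}^n\sum_{j=1}^n M_{ij}$ subject to $$\sum_{j=1}^n M_{ji}-\sum_{j=1}^n M_{ij}=b_i\quad\text{for all } i\in\{1,\dots,n\},\qquad 0\le M_{ij}\le L_{ij}\quad\text{for all } i,j\in\{1,\dots,n\}.$$ Put $T=L-M$. Then $(T,\mathbf{0})$ is a balanced payment subsystem of $L$, i.e. it requires no external liquidity source to clear its obligations.
   Context: A nominal liability matrix is a real $n\times n$ matrix $L$ with zero diagonal, where $L_{ij}$ is the total amount that firm $i$ owes firm $j$. The debt of firm $i$ is $d_i=\sum_{j=1}^n L_{ij}$, its credit is $c_i=\sum_{j=1}^n L_{ji}$, and the net position vector is $\mathbf{b}=\mathbf{c}-\mathbf{d}$. A payment system $(L,\mathbf{f})$ consists of a nominal liability matrix $L$ and an external cashflow vector $\mathbf{f}\in\mathbb{R}^n$ ($f_i>0$ means cash flowing from an external liquidity source to firm $i$, $f_i<0$ means cash flowing from firm $i$ back to it). It is balanced (can discharge all its obligations) if for every firm the sum of all incoming and outgoing cashflows is zero: $c_i-d_i+f_i=0$ for all $i$. A balanced payment subsystem $(T,\mathbf{0})$ of $L$ is a matrix $T$ with $0\le T_{ij}\le L_{ij}$ for all $i,j$ such that the payment system $(T,\mathbf{0})$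 is balanced, i.e. $\sum_{j}T_{ij}-\sum_{j}T_{ji}=0$ for all $i$. *)

theory Defs
  imports "HOL-Analysis.Analysis"
begin

(* Firms are the elements of the finite index type 'n. The entry L $ i $ j is what
   firm i owes firm j. Nonnegativity of L is not part of the definition: only a real
   matrix with zero diagonal is asked for. *)
definition nominal_liability_matrix :: "real^'n^'n \<Rightarrow> bool" where
  "nominal_liability_matrix L \<longleftrightarrow> (\<forall>i. L $ i $ i = 0)"

definition debt :: "real^'n^'n \<Rightarrow> real^'n" where
  "debt L = (\<chi> i. \<Sum>j\<in>UNIV. L $ i $ j)"

definition credit :: "real^'n^'n \<Rightarrow> real^'n" where
  "credit L = (\<chi> i. \<Sum>j\<in>UNIV. L $ j $ i)"

definition net_position :: "real^'n^'n \<Rightarrow> real^'n" where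
  "net_position L = credit L - debt L"

(* A payment system is a pair of a nominal liability matrix and an external cashflow
   vector; the first conjunct says that (L, f) is one. *)
definition balanced_payment_system :: "real^'n^'n \<Rightarrow> real^'n \<Rightarrow> bool" where
  "balanced_payment_system L f \<longleftrightarrow>
     nominal_liability_matrix L \<and> (\<forall>i. credit L $ i - debt L $ i + f $ i = 0)"

definition balanced_payment_subsystem :: "real^'n^'n \<Rightarrow> real^'n^'n \<Rightarrow> bool" where
  "balanced_payment_subsystem L T \<longleftrightarrow>
     (\<forall>i j. 0 \<le> T $ i $ j \<and> T $ i $ j \<le> L $ i $ j) \<and> balanced_payment_system T 0"

definition flow_cost :: "real^'n^'n \<Rightarrow> real" where
  "flow_cost M = (\<Sum>i\<in>UNIV. \<Sum>j\<in>UNIV. M $ i $ j)"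

definition feasible_flow :: "real^'n^'n \<Rightarrow> real^'n^'n \<Rightarrow> bool" where
  "feasible_flow L M \<longleftrightarrow>
     (\<forall>i. (\<Sum>j\<in>UNIV. M $ j $ i) - (\<Sum>j\<in>UNIV. M $ i $ j) = net_position L $ i) \<and>
     (\<forall>i j. 0 \<le> M $ i $ j \<and> M $ i $ j \<le> L $ i $ j)"

definition min_cost_max_flow :: "real^'n^'n \<Rightarrow> real^'n^'n \<Rightarrow> bool" where
  "min_cost_max_flow L M \<longleftrightarrow> is_arg_min flow_cost (feasible_flow L) M"

end

theory Submission
  imports Defs
begin

text \<open>The net position is linear in the matrix, and a feasible flow \<open>M\<close> has the
  same net position as \<open>L\<close>, so that of \<open>L - M\<close> vanishes. The bounds 0
  \<le> M \<le> L turn into 0 \<le> L - M \<le> L. A minimiser is in particular feasible, so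
  \<open>feasible_flow_complement\<close> applies.\<close>

lemma feasible_flow_complement:
  fixes L M :: "real^'n^'n"
  assumes "nominal_liability_matrix L" and "feasible_flow L M"
  shows "balanced_payment_subsystem L (L - M)"
proof -
  have bounds: "0 \<le> M $ i $ j" "M $ i $ j \<le> L $ i $ j" for i j
    using assms(2) by (simp_all add: feasible_flow_def)
  \<comment> \<open>The capacity bounds squeeze the diagonal of \<open>M\<close> between 0 and the
    zero diagonal of \<open>L\<close>.\<close>
  have "M $ i $ i = 0" for i
    using bounds[of i i] assms(1) by (simp add: nominal_liability_matrix_def)
  then have "nominal_liability_matrix (L - M)"
    using assms(1) by (simp add: nominal_liability_matrix_def)
  moreover have "credit (L - M) $ i - debt (L - M) $ i = 0" for i
  proof -
    \<comment> \<open>Inflow minus outflow of \<open>M\<close> at firm \<open>i\<close> is its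
      credit minus its debt.\<close>
    have "net_position M $ i = net_position L $ i"
      using assms(2) by (simp add: feasible_flow_def net_position_def credit_def debt_def)
    then show ?thesis
      by (simp add: net_position_def credit_def debt_def sum_subtractf)
  qed
  ultimately show ?thesis
    using bounds by (simp add: balanced_payment_subsystem_def balanced_payment_system_def)
qed

theorem theorem14:
  fixes L M T :: "real^'n^'n"
  assumes "nominal_liability_matrix L"
    and "min_cost_max_flow L M"
    and "T = L - M"
  shows "balanced_payment_subsystem L T"
  using assms feasible_flow_complement
  by (auto simp: min_cost_max_flow_def is_arg_min_def)

end
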